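(* Let $L\ge1$ be an integer, $\sigma^2>0$ and $m_I>0$. Let $g_d,g_1,\dots,g_L$ be mutually independent random variables such that $g_d$ is a unit-mean $\kappa$-$\mu$ shadowed power random variable with parameters $(\kappa,\mu,m)$ (positive reals) and $g_1,\dots,g_L$ are identically distributed unit-mean Nakagami power random variables with parameter $m_I$. Suppose $\mu>0.5$. Then the error vector magnitude in the presence of interference and noise, $\mathrm{EVM}=\mathbb{E}\left[\sqrt{\left(\sum_{l=1}^L g_l+\sigma^2\right)/g_d}\right]$, equals $$\frac{U\!\left(m_IL,\ \tfrac32+m_IL,\ \sigma^2m_I\right)\sqrt{\sigma^2\mu(1+\kappa)}\left(\frac{m}{\mu\kappa+m}\right)^{m}\Gamma(\mu-0.5)\;{}_2F_1\!\left(\mu-\tfrac12,\,m;\,\mu;\,\frac{\mu\kappa}{m+\mu\kappa}\right)}{(\sigma^2m_I)^{-m_IL}\,\Gamma(\mu)}.$$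
   Context: Unit-mean $\kappa$-$\mu$ shadowed power random variable with parameters $(\kappa,\mu,m)$, $\kappa,\mu,m>0$: a positive random variable with density $$f(x)=\frac{\theta_1^{m-\mu}x^{\mu-1}}{\theta_2^m\,\Gamma(\mu)}\,e^{-x/\theta_1}\,{}_1F_1\!\left(m;\mu;\frac{(\theta_2-\theta_1)x}{\theta_1\theta_2}\right),\quad x>0,\qquad \theta_1=\frac{1}{\mu(1+\kappa)},\ \theta_2=\frac{\mu\kappa+m}{\mu(1+\kappa)m}.$$ Unit-mean Nakagami power random variable with parameter $m_I>0$: a Gamma random variable with shape $m_I$ and scale $1/m_I$. EVM: a desired signal with fading power $g_d$ is received together with $L$ interferers with fading powers $g_1,\dots,g_L$ and zero-mean complex Gaussian noise of variance $\sigma^2$; with unit symbol energy, the error vector magnitude is $\mathrm{EVM}=\mathbb{E}\left[\sqrt{\left(\sum_{l=1}^L g_l+\sigma^2\right)/g_d}\right]$. ${}_1F_1$ is Kummer's confluent hypergeometric function, ${}_2F_1$ the Gauss hypergeometric function, and $U(a,b,z)=\frac{1}{\Gamma(a)}\int_0^\infty e^{-zt}t^{a-1}(1+t)^{b-a-1}\,dt$ ($a,z>0$) the Tricomi confluent hypergeometric function. *)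

theory Defs
  imports "HOL-Probability.Probability"
begin

text \<open>
  Kummer's \<open>\<^sub>1F\<^sub>1\<close> and Gauss' \<open>\<^sub>2F\<^sub>1\<close>, via the library's generalized hypergeometric power series.
  The series for \<open>\<^sub>1F\<^sub>1\<close> converges everywhere.  That for \<open>\<^sub>2F\<^sub>1\<close> is used only for \<open>\<bar>z\<bar> < 1\<close>,
  its disc of convergence; no analytic continuation is included.
\<close>

definition kummer_1F1 :: "real \<Rightarrow> real \<Rightarrow> real \<Rightarrow> real" where
  "kummer_1F1 a b z = eval_fps (fps_hypergeo [a] [b] 1) z"

definition gauss_2F1 :: "real \<Rightarrow> real \<Rightarrow> real \<Rightarrow> real \<Rightarrow> real" where
  "gauss_2F1 a b c z = eval_fps (fps_hypergeo [a, b] [c] 1) z"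

lemma kummer_1F1_series:
  "kummer_1F1 a b z = (\<Sum>n. pochhammer a n / (pochhammer b n * fact n) * z ^ n)"
  by (simp add: kummer_1F1_def eval_fps_def fps_hypergeo_nth)

lemma gauss_2F1_series:
  "gauss_2F1 a b c z =
     (\<Sum>n. pochhammer a n * pochhammer b n / (pochhammer c n * fact n) * z ^ n)"
  by (simp add: gauss_2F1_def eval_fps_def fps_hypergeo_nth)

text \<open>Tricomi's function, by its integral representation (meaningful for \<open>a, z > 0\<close>).\<close>

definition tricomi_U :: "real \<Rightarrow> real \<Rightarrow> real \<Rightarrow> real" where
  "tricomi_U a b z =
     1 / Gamma a * (LBINT t:{0<..}. exp (- z * t) * t powr (a - 1) * (1 + t) powr (b - a - 1))"

definition kms_theta1 :: "real \<Rightarrow> real \<Rightarrow> real" where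
  "kms_theta1 \<kappa> \<mu> = 1 / (\<mu> * (1 + \<kappa>))"

definition kms_theta2 :: "real \<Rightarrow> real \<Rightarrow> real \<Rightarrow> real" where
  "kms_theta2 \<kappa> \<mu> m = (\<mu> * \<kappa> + m) / (\<mu> * (1 + \<kappa>) * m)"

definition kms_density :: "real \<Rightarrow> real \<Rightarrow> real \<Rightarrow> real \<Rightarrow> real" where
  "kms_density \<kappa> \<mu> m x =
     (let \<theta>\<^sub>1 = kms_theta1 \<kappa> \<mu>; \<theta>\<^sub>2 = kms_theta2 \<kappa> \<mu> m in
      if x > 0 then
        \<theta>\<^sub>1 powr (m - \<mu>) * x powr (\<mu> - 1) / (\<theta>\<^sub>2 powr m * Gamma \<mu>) * exp (- x / \<theta>\<^sub>1)
          * kummer_1F1 m \<mu> ((\<theta>\<^sub>2 - \<theta>\<^sub>1) * x / (\<theta>\<^sub>1 * \<theta>\<^sub>2))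
      else 0)"

definition gamma_density :: "real \<Rightarrow> real \<Rightarrow> real \<Rightarrow> real" where
  "gamma_density k \<theta> x =
     (if x > 0 then x powr (k - 1) * exp (- x / \<theta>) / (Gamma k * \<theta> powr k) else 0)"

text \<open>
  Unit-mean \<open>\<kappa>\<close>-\<open>\<mu>\<close> shadowed and Nakagami power random variables.  Both densities vanish outside
  \<open>x > 0\<close>, so the variables are positive almost surely.
\<close>

definition kms_power_rv :: "'a measure \<Rightarrow> ('a \<Rightarrow> real) \<Rightarrow> real \<Rightarrow> real \<Rightarrow> real \<Rightarrow> bool" where
  "kms_power_rv M X \<kappa> \<mu> m \<longleftrightarrow> distributed M lborel X (\<lambda>x. ennreal (kms_density \<kappa> \<mu> m x))"

definition nakagami_power_rv :: "'a measure \<Rightarrow> ('a \<Rightarrow> real) \<Rightarrow> real \<Rightarrow> bool" where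
  "nakagami_power_rv M X m\<^sub>I \<longleftrightarrow> distributed M lborel X (\<lambda>x. ennreal (gamma_density m\<^sub>I (1 / m\<^sub>I) x))"

text \<open>
  The last argument is the noise variance.  As a Bochner integral the value is \<open>0\<close> if the
  expectation is infinite, so an equation of this with a positive number includes its finiteness.
\<close>

definition EVM ::
    "'a measure \<Rightarrow> ('a \<Rightarrow> real) \<Rightarrow> (nat \<Rightarrow> 'a \<Rightarrow> real) \<Rightarrow> nat \<Rightarrow> real \<Rightarrow> real" where
  "EVM M g\<^sub>d g L v = (\<integral>\<omega>. sqrt (((\<Sum>l=1..L. g l \<omega>) + v) / g\<^sub>d \<omega>) \<partial>M)"

end

theory Submission
  imports Defs "HOL-Real_Asymp.Real_Asymp"
begin

text \<open>
  By independence the expectation factors as \<open>E (g\<^sub>d powr (- 1 / 2)) * E (sqrt (S + \<sigma>\<^sup>2))\<close>, where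
  \<open>S\<close> is the total interference.  \<open>S\<close> is Gamma distributed with shape \<open>m\<^sub>I * L\<close> by the Beta integral,
  and scaling by \<open>\<sigma>\<^sup>2\<close> turns the second factor into Tricomi's integral.  Integrating the Kummer
  series of the density of \<open>g\<^sub>d\<close> term by term gives the Gauss series in the first factor.
\<close>

section \<open>Gamma densities\<close>

lemma gamma_density_measurable [measurable]: "gamma_density k \<theta> \<in> borel_measurable borel"
  unfolding gamma_density_def by measurable

lemma gamma_density_nonneg: "k > 0 \<Longrightarrow> 0 \<le> gamma_density k \<theta> x"
  by (simp add: gamma_density_def)

text \<open>Rescaling by \<open>\<theta>\<close> reduces the total mass to Euler's integral for
  \<open>Gamma k\<close>.\<close>

lemma nn_integral_gamma_density:
  assumes "k > 0" "\<theta> > 0"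
  shows "(\<integral>\<^sup>+x. ennreal (gamma_density k \<theta> x) \<partial>lborel) = 1"
proof -
  have eq: "gamma_density k \<theta> (\<theta> * x) =
      1 / (\<theta> * Gamma k) * (indicator {0..} x * x powr (k - 1) / exp x)" for x
  proof (cases "x > 0")
    case True
    then have "(\<theta> * x) powr (k - 1) = \<theta> powr k / \<theta> * x powr (k - 1)"
      using assms by (simp add: powr_mult powr_diff)
    then show ?thesis
      using True assms by (simp add: gamma_density_def) (simp add: exp_minus field_simps)
  next
    case False
    \<comment> \<open>At \<open>x = 0\<close> the indicator is 1, but the power factor vanishes
      because \<open>0 powr (k - 1) = 0\<close> by convention.\<close>
    then show ?thesis
      using assms by (cases "x = 0") (auto simp: gamma_density_def zero_less_mult_iff)
  qed
  have "(\<integral>\<^sup>+x. ennreal (gamma_density k \<theta> x) \<partial>lborel) =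
      ennreal \<theta> * (\<integral>\<^sup>+x. ennreal (gamma_density k \<theta> (\<theta> * x)) \<partial>lborel)"
    using assms by (subst nn_integral_real_affine[where c = \<theta> and t = 0]) auto
  also have "(\<integral>\<^sup>+x. ennreal (gamma_density k \<theta> (\<theta> * x)) \<partial>lborel) =
      (\<integral>\<^sup>+x. ennreal (1 / (\<theta> * Gamma k)) * ennreal (indicator {0..} x * x powr (k - 1) / exp x) \<partial>lborel)"
    unfolding eq using assms by (intro nn_integral_cong ennreal_mult') simp
  also have "\<dots> = ennreal (1 / (\<theta> * Gamma k)) * ennreal (Gamma k)"
    using assms by (subst nn_integral_cmult) (auto simp: Gamma_conv_nn_integral_real)
  also have "ennreal \<theta> * \<dots> = ennreal (\<theta> * (1 / (\<theta> * Gamma k) * Gamma k))"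
    using assms by (simp add: ennreal_mult del: times_divide_eq_left times_divide_eq_right)
  also have "\<theta> * (1 / (\<theta> * Gamma k) * Gamma k) = 1"
    using assms less_imp_neq[OF Gamma_real_pos[OF assms(1)]] by simp
  finally show ?thesis by simp
qed

lemma integrable_gamma_density:
  assumes "k > 0" "\<theta> > 0"
  shows "integrable lborel (gamma_density k \<theta>)"
  by (rule integrableI_nonneg) (use assms in \<open>auto simp: gamma_density_nonneg nn_integral_gamma_density\<close>)

text \<open>The common scale makes the two exponentials combine to
  \<open>exp (- x / \<theta>)\<close>, which does not depend on \<open>y\<close>. The substitution
  \<open>y = x * t\<close> then leaves the Beta integral, whose Gamma quotient replaces
  \<open>Gamma a * Gamma b\<close> by \<open>Gamma (a + b)\<close>.\<close>

lemma gamma_density_convolution: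
  assumes "a > 0" "b > 0" "\<theta> > 0"
  shows "(\<integral>\<^sup>+y. ennreal (gamma_density a \<theta> (x - y)) * ennreal (gamma_density b \<theta> y) \<partial>lborel) =
    ennreal (gamma_density (a + b) \<theta> x)"
proof (cases "x > 0")
  case False
  then have "ennreal (gamma_density a \<theta> (x - y)) * ennreal (gamma_density b \<theta> y) = 0" for y
    by (auto simp: gamma_density_def)
  then have "(\<integral>\<^sup>+y. ennreal (gamma_density a \<theta> (x - y)) * ennreal (gamma_density b \<theta> y) \<partial>lborel) = 0"
    by (simp only: nn_integral_0_iff_AE simp_thms eventually_True nn_integral_const mult_zero_left)
  with False show ?thesis
    by (simp add: gamma_density_def)
next
  case True
  \<comment> \<open>The part of the integrand that does not depend on \<open>t\<close>. The two
    densities contribute the power \<open>a + b - 2\<close> of \<open>x\<close>, and the Jacobian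
    \<open>x\<close> later restores \<open>a + b - 1\<close>.\<close>
  define C where
    "C = x powr (a + b - 1) / x * exp (- x / \<theta>) / (Gamma a * Gamma b * \<theta> powr (a + b))"
  have C: "C \<ge> 0"
    using assms True by (simp add: C_def)
  have eq: "gamma_density a \<theta> (x - x * t) * gamma_density b \<theta> (x * t) =
      C * (indicator {0..1} t * (t powr (b - 1) * (1 - t) powr (a - 1)))" for t
  proof (cases "0 < t \<and> t < 1")
    case t: True
    have "x - x * t = x * (1 - t)"
      by (simp add: algebra_simps)
    moreover have "x * (1 - t) > 0" "x * t > 0"
      using True t by auto
    moreover have "(x * (1 - t)) powr (a - 1) = x powr (a - 1) * (1 - t) powr (a - 1)"
      "(x * t) powr (b - 1) = x powr (b - 1) * t powr (b - 1)"
      using True t by (simp_all add: powr_mult)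
    moreover have "exp (- (x * (1 - t)) / \<theta>) * exp (- (x * t) / \<theta>) = exp (- x / \<theta>)"
      using assms by (simp flip: exp_add add: field_simps)
    moreover have "x powr (a + b - 1) / x = x powr (a - 1) * x powr (b - 1)"
      using True by (simp add: powr_add powr_diff)
    ultimately show ?thesis
      using t by (simp add: gamma_density_def C_def powr_add) (simp add: field_simps)
  next
    case False
    have "\<not> (0 < x - x * t \<and> 0 < x * t)"
    proof
      assume "0 < x - x * t \<and> 0 < x * t"
      then have "0 < x * (1 - t)" "0 < x * t"
        by (auto simp: algebra_simps)
      with True False show False
        by (auto simp: zero_less_mult_iff)
    qed
    then have "gamma_density a \<theta> (x - x * t) * gamma_density b \<theta> (x * t) = 0"
      by (auto simp: gamma_density_def)
    \<comment> \<open>The endpoints 0 and 1 lie in the support of the indicator; there the product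
      vanishes because \<open>0 powr\<close> anything is 0.\<close>
    moreover have "indicator {0..1} t * (t powr (b - 1) * (1 - t) powr (a - 1)) = 0"
      using False by (auto simp: indicator_def)
    ultimately show ?thesis by (simp only: mult_zero_right)
  qed
  have "(\<integral>\<^sup>+y. ennreal (gamma_density a \<theta> (x - y)) * ennreal (gamma_density b \<theta> y) \<partial>lborel) =
      ennreal x * (\<integral>\<^sup>+t. ennreal (gamma_density a \<theta> (x - x * t)) * ennreal (gamma_density b \<theta> (x * t)) \<partial>lborel)"
    using True by (subst nn_integral_real_affine[where c = x and t = 0]) auto
  also have "(\<integral>\<^sup>+t. ennreal (gamma_density a \<theta> (x - x * t)) * ennreal (gamma_density b \<theta> (x * t)) \<partial>lborel) =
      (\<integral>\<^sup>+t. ennreal C * ennreal (indicator {0..1} t * (t powr (b - 1) * (1 - t) powr (a - 1))) \<partial>lborel)"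
    using assms C by (intro nn_integral_cong) (simp add: eq gamma_density_nonneg flip: ennreal_mult')
  also have "\<dots> = ennreal C * ennreal (Beta b a)"
    using nn_integral_has_integral_lebesgue[OF _ has_integral_Beta_real[of b a]] assms
    by (subst nn_integral_cmult) auto
  also have "ennreal x * \<dots> = ennreal (x * (C * Beta b a))"
    using True C assms by (simp add: Beta_def flip: ennreal_mult')
  also have "x * (C * Beta b a) = gamma_density (a + b) \<theta> x"
    using True assms less_imp_neq[OF Gamma_real_pos[OF assms(1)]] less_imp_neq[OF Gamma_real_pos[OF assms(2)]]
    by (simp add: C_def Beta_def gamma_density_def field_simps)
  finally show ?thesis .
qed

text \<open>Induction on the index set, with independence turning each added summand into a
  convolution. The induction starts at a singleton because the empty sum is constantly 0 and has no
  Lebesgue density.\<close>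

lemma (in prob_space) gamma_distributed_sum:
  assumes "finite I" "I \<noteq> {}" "\<theta> > 0" "\<And>i. i \<in> I \<Longrightarrow> k i > 0"
    and "\<And>i. i \<in> I \<Longrightarrow> distributed M lborel (X i) (\<lambda>x. ennreal (gamma_density (k i) \<theta> x))"
    and "indep_vars (\<lambda>_. borel) X I"
  shows "distributed M lborel (\<lambda>\<omega>. \<Sum>i\<in>I. X i \<omega>) (\<lambda>x. ennreal (gamma_density (\<Sum>i\<in>I. k i) \<theta> x))"
  using assms
proof (induction rule: finite_ne_induct)
  case (singleton i)
  then show ?case by simp
next
  case (insert i I)
  have IH: "distributed M lborel (\<lambda>\<omega>. \<Sum>i\<in>I. X i \<omega>) (\<lambda>x. ennreal (gamma_density (\<Sum>i\<in>I. k i) \<theta> x))"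
    using insert by (intro insert.IH) (auto intro: indep_vars_subset)
  have "distributed M lborel (\<lambda>\<omega>. X i \<omega> + (\<Sum>i\<in>I. X i \<omega>))
      (\<lambda>x. \<integral>\<^sup>+y. ennreal (gamma_density (k i) \<theta> (x - y)) * ennreal (gamma_density (\<Sum>i\<in>I. k i) \<theta> y) \<partial>lborel)"
    using insert IH by (intro distributed_convolution indep_vars_sum) auto
  moreover have "(\<Sum>i\<in>I. k i) > 0"
    using insert by (intro sum_pos) auto
  ultimately show ?case
    using insert by (simp add: gamma_density_convolution)
qed

text \<open>Substituting \<open>x = v * t\<close> turns \<open>sqrt (x + v)\<close> into
  \<open>sqrt v * (1 + t) powr (1 / 2)\<close>. In Tricomi's integral with first parameter
  \<open>k\<close>, the exponent 1/2 forces the second parameter to be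
  \<open>3 / 2 + k\<close>.\<close>

lemma has_bochner_integral_gamma_density_sqrt:
  assumes "k > 0" "\<theta> > 0" "v > 0"
  shows "has_bochner_integral lborel (\<lambda>x. gamma_density k \<theta> x * sqrt (x + v))
    ((v / \<theta>) powr k * sqrt v * tricomi_U k (3 / 2 + k) (v / \<theta>))"
proof -
  \<comment> \<open>Multiplication by \<open>x\<close> only raises the shape by one. This makes the
    linear bound on the square root below integrable.\<close>
  have mult_density: "x * gamma_density k \<theta> x = k * \<theta> * gamma_density (k + 1) \<theta> x" for x
  proof (cases "x > 0")
    case True
    then have "x powr k = x * x powr (k - 1)"
      by (simp add: powr_diff)
    with True assms show ?thesis
      using Gamma_plus1[of k] Gamma_real_pos[of k]
      by (simp add: gamma_density_def powr_add nonpos_Ints_def field_simps)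
  qed (simp add: gamma_density_def)
  have int: "integrable lborel (\<lambda>x. gamma_density k \<theta> x * sqrt (x + v))"
  proof (rule Bochner_Integration.integrable_bound)
    show "integrable lborel (\<lambda>x. k * \<theta> * gamma_density (k + 1) \<theta> x + (v + 1) * gamma_density k \<theta> x)"
      using assms by (intro Bochner_Integration.integrable_add integrable_mult_right integrable_gamma_density) auto
    have "norm (gamma_density k \<theta> x * sqrt (x + v)) \<le>
        norm (k * \<theta> * gamma_density (k + 1) \<theta> x + (v + 1) * gamma_density k \<theta> x)" for x
    proof (cases "x > 0")
      case True
      have "sqrt (x + v) \<le> sqrt ((x + v + 1)\<^sup>2)"
        unfolding real_sqrt_le_iff using True assms by (simp add: power2_eq_square algebra_simps add_increasing)
      then have "sqrt (x + v) \<le> x + v + 1"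
        using True assms by simp
      then have "gamma_density k \<theta> x * sqrt (x + v) \<le> gamma_density k \<theta> x * (x + v + 1)"
        using assms by (intro mult_left_mono gamma_density_nonneg)
      also have "\<dots> = k * \<theta> * gamma_density (k + 1) \<theta> x + (v + 1) * gamma_density k \<theta> x"
        using mult_density[of x] by (simp add: algebra_simps)
      finally show ?thesis
        using True assms gamma_density_nonneg[of k \<theta> x] by simp
    qed (simp add: gamma_density_def)
    then show "AE x in lborel. norm (gamma_density k \<theta> x * sqrt (x + v)) \<le>
        norm (k * \<theta> * gamma_density (k + 1) \<theta> x + (v + 1) * gamma_density k \<theta> x)"
      by simp
  qed simp
  have eq: "gamma_density k \<theta> (v * t) * sqrt (v * t + v) =
      (v / \<theta>) powr k * sqrt v / (v * Gamma k) *
        (indicator {0<..} t *\<^sub>R (exp (- (v / \<theta>) * t) * t powr (k - 1) * (1 + t) powr (1 / 2)))" for t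
  proof (cases "t > 0")
    case True
    have "sqrt (v * t + v) = sqrt v * (1 + t) powr (1 / 2)"
      using True by (simp add: powr_half_sqrt flip: real_sqrt_mult) (simp add: algebra_simps)
    moreover have "(v * t) powr (k - 1) = v powr k / v * t powr (k - 1)"
      using True assms by (simp add: powr_mult powr_diff)
    ultimately show ?thesis
      using True assms by (simp add: gamma_density_def powr_divide) (simp add: mult_ac)
  next
    case False
    then show ?thesis
      using assms by (auto simp: gamma_density_def zero_less_mult_iff)
  qed
  have "(LBINT x. gamma_density k \<theta> x * sqrt (x + v)) =
      v * (LBINT t. gamma_density k \<theta> (v * t) * sqrt (v * t + v))"
    using assms by (subst lborel_integral_real_affine[where c = v and t = 0]) auto
  also have "\<dots> = (v / \<theta>) powr k * sqrt v * tricomi_U k (3 / 2 + k) (v / \<theta>)"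
    unfolding eq using assms by (simp add: tricomi_U_def set_lebesgue_integral_def)
  finally show ?thesis
    using int by (simp add: has_bochner_integral_iff)
qed

section \<open>Moments of the shadowed distribution\<close>

text \<open>Ratio test: positive parameters keep all coefficients nonzero, and the quotients of
  consecutive coefficients tend to 1, the radius of convergence.\<close>

lemma summable_gauss_2F1:
  fixes a b c z :: real
  assumes "a > 0" "b > 0" "c > 0" "\<bar>z\<bar> < 1"
  shows "summable (\<lambda>n. pochhammer a n * pochhammer b n / (pochhammer c n * fact n) * z ^ n)"
proof (rule summable_in_conv_radius)
  let ?f = "\<lambda>n. pochhammer a n * pochhammer b n / (pochhammer c n * fact n)"
  have nz: "?f n \<noteq> 0" for n
    using assms pochhammer_pos[of a n] pochhammer_pos[of b n] pochhammer_pos[of c n] by simp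
  have "norm (?f n) / norm (?f (Suc n)) = (c + n) * (1 + n) / ((a + n) * (b + n))" for n
    using assms pochhammer_pos[of a n] pochhammer_pos[of b n] pochhammer_pos[of c n]
    by (simp add: pochhammer_Suc divide_simps abs_mult)
  moreover have "(\<lambda>n. (c + real n) * (1 + real n) / ((a + real n) * (b + real n))) \<longlonglongrightarrow> 1"
    by real_asymp
  ultimately have "(\<lambda>n. norm (?f n) / norm (?f (Suc n))) \<longlonglongrightarrow> 1"
    by simp
  then have "conv_radius ?f = 1"
    using nz by (subst conv_radius_ratio_limit_nonzero[where c = 1]) (auto simp: one_ereal_def)
  with assms show "ereal (norm z) < conv_radius ?f"
    by simp
qed

text \<open>Ratio test as for the Gauss series, but with one numerator parameter fewer the quotients
  grow without bound, so the radius is infinite.\<close>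

lemma summable_kummer_1F1:
  fixes a b z :: real
  assumes "a > 0" "b > 0"
  shows "summable (\<lambda>n. pochhammer a n / (pochhammer b n * fact n) * z ^ n)"
proof (rule summable_in_conv_radius)
  let ?f = "\<lambda>n. pochhammer a n / (pochhammer b n * fact n)"
  have nz: "?f n \<noteq> 0" for n
    using assms pochhammer_pos[of a n] pochhammer_pos[of b n] by simp
  have "norm (?f n) / norm (?f (Suc n)) = (b + n) * (1 + n) / (a + n)" for n
    using assms pochhammer_pos[of a n] pochhammer_pos[of b n]
    by (simp add: pochhammer_Suc divide_simps abs_mult)
  moreover have "filterlim (\<lambda>n. (b + real n) * (1 + real n) / (a + real n)) at_top at_top"
    by real_asymp
  ultimately have "(\<lambda>n. ereal (norm (?f n) / norm (?f (Suc n)))) \<longlonglongrightarrow> \<infinity>"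
    by (simp add: tendsto_PInfty_eq_at_top)
  then have "conv_radius ?f = \<infinity>"
    using nz by (intro conv_radius_ratio_limit_ereal_nonzero) auto
  then show "ereal (norm z) < conv_radius ?f"
    by simp
qed

text \<open>Since \<open>\<theta>1 \<le> \<theta>2\<close>, the Kummer argument is nonnegative for
  \<open>x > 0\<close>, and so is every term of the series. Nonnegativity is what lets integrals
  against the \<open>ennreal\<close> density be computed with the real-valued one.\<close>

lemma kms_density_nonneg:
  assumes "\<kappa> > 0" "\<mu> > 0" "m > 0"
  shows "0 \<le> kms_density \<kappa> \<mu> m x"
proof (cases "x > 0")
  case True
  have pos: "\<mu> * \<kappa> > 0" "\<mu> * (1 + \<kappa>) > 0" "\<mu> * \<kappa> + m > 0"
    using assms by (auto intro: add_pos_pos)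
  have "(\<mu> * \<kappa> + m) / m \<ge> 1"
    using assms pos by simp
  then have "kms_theta1 \<kappa> \<mu> * 1 \<le> kms_theta1 \<kappa> \<mu> * ((\<mu> * \<kappa> + m) / m)"
    using pos by (intro mult_left_mono) (auto simp: kms_theta1_def)
  then have "kms_theta1 \<kappa> \<mu> \<le> kms_theta2 \<kappa> \<mu> m"
    by (simp add: kms_theta1_def kms_theta2_def)
  moreover have "kms_theta1 \<kappa> \<mu> > 0" "kms_theta2 \<kappa> \<mu> m > 0"
    using assms pos by (auto simp: kms_theta1_def kms_theta2_def intro!: divide_pos_pos)
  moreover have "kummer_1F1 m \<mu> z \<ge> 0" if "z \<ge> 0" for z
    unfolding kummer_1F1_series using assms that
    by (intro suminf_nonneg summable_kummer_1F1 mult_nonneg_nonneg divide_nonneg_nonneg)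
       (auto intro: pochhammer_nonneg)
  ultimately show ?thesis
    using True assms by (simp add: kms_density_def Let_def)
qed (simp add: kms_density_def)

text \<open>
  Multiplying the \<open>n\<close>-th term of the Kummer series by \<open>x powr p\<close> gives a multiple of the Gamma
  density of shape \<open>\<mu> + p + n\<close>, so the moment is the sum of the coefficients.
\<close>

lemma has_bochner_integral_kms_density_powr:
  assumes "\<kappa> > 0" "\<mu> > 0" "m > 0" "\<mu> + p > 0"
  shows "has_bochner_integral lborel (\<lambda>x. kms_density \<kappa> \<mu> m x * x powr p)
    ((m / (\<mu> * \<kappa> + m)) powr m * kms_theta1 \<kappa> \<mu> powr p * Gamma (\<mu> + p) / Gamma \<mu>
      * gauss_2F1 (\<mu> + p) m \<mu> (\<mu> * \<kappa> / (m + \<mu> * \<kappa>)))"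
proof -
  define \<theta>1 \<theta>2 z where "\<theta>1 = kms_theta1 \<kappa> \<mu>" and "\<theta>2 = kms_theta2 \<kappa> \<mu> m"
    and "z = \<mu> * \<kappa> / (m + \<mu> * \<kappa>)"
  have pos: "\<mu> * \<kappa> > 0" "\<mu> * (1 + \<kappa>) > 0" "\<mu> * \<kappa> + m > 0"
    using assms by (auto intro: add_pos_pos)
  have \<theta>: "\<theta>1 > 0" "\<theta>2 > 0"
    using assms pos by (auto simp: \<theta>1_def \<theta>2_def kms_theta1_def kms_theta2_def intro!: divide_pos_pos)
  have ratio: "\<theta>1 / \<theta>2 = m / (\<mu> * \<kappa> + m)"
    using assms pos by (simp add: \<theta>1_def \<theta>2_def kms_theta1_def kms_theta2_def)
  have z: "0 \<le> z" "z < 1"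
    using assms pos by (auto simp: z_def)
  \<comment> \<open>This identifies the Gauss argument \<open>z\<close> with the factor of
    \<open>x / \<theta>1\<close> in the Kummer argument, so every term of the series carries the
    same scale \<open>\<theta>1\<close>.\<close>
  have "z = 1 - \<theta>1 / \<theta>2"
    unfolding ratio z_def using assms pos by (simp add: field_simps)
  then have "\<theta>2 - \<theta>1 = z * \<theta>2"
    using \<theta> by (simp add: field_simps)
  then have z_scaled: "(\<theta>2 - \<theta>1) * x / (\<theta>1 * \<theta>2) = z * (x / \<theta>1)" for x
    using \<theta> by simp
  define A where "A = (m / (\<mu> * \<kappa> + m)) powr m * \<theta>1 powr p * Gamma (\<mu> + p) / Gamma \<mu>"
  define c where "c n = pochhammer (\<mu> + p) n * pochhammer m n / (pochhammer \<mu> n * fact n) * z ^ n" for n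
  have gauss: "gauss_2F1 (\<mu> + p) m \<mu> z = suminf c"
    unfolding gauss_2F1_series c_def[abs_def] ..
  have A: "A \<ge> 0"
    using assms by (simp add: A_def)
  have c: "c n \<ge> 0" for n
    using assms z by (auto simp: c_def intro!: divide_nonneg_nonneg mult_nonneg_nonneg pochhammer_nonneg)
  have summable_c: "summable c"
    unfolding c_def using assms z by (intro summable_gauss_2F1) auto
  have sums: "(\<lambda>n. A * c n * gamma_density (\<mu> + p + real n) \<theta>1 x) sums (kms_density \<kappa> \<mu> m x * x powr p)" for x
  proof (cases "x > 0")
    case False
    then show ?thesis
      by (simp add: gamma_density_def kms_density_def)
  next
    case True
    define B where "B = \<theta>1 powr (m - \<mu>) * x powr (\<mu> - 1) / (\<theta>2 powr m * Gamma \<mu>) * exp (- x / \<theta>1) * x powr p"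
    have "(\<lambda>n. B * (pochhammer m n / (pochhammer \<mu> n * fact n) * (z * (x / \<theta>1)) ^ n)) sums
        (B * kummer_1F1 m \<mu> (z * (x / \<theta>1)))"
      unfolding kummer_1F1_series
      using assms by (intro sums_mult summable_sums summable_kummer_1F1) auto
    also have "B * kummer_1F1 m \<mu> (z * (x / \<theta>1)) = kms_density \<kappa> \<mu> m x * x powr p"
      using True by (simp add: kms_density_def B_def z_scaled Let_def flip: \<theta>1_def \<theta>2_def)
    also have "(\<lambda>n. B * (pochhammer m n / (pochhammer \<mu> n * fact n) * (z * (x / \<theta>1)) ^ n)) =
        (\<lambda>n. A * c n * gamma_density (\<mu> + p + real n) \<theta>1 x)"
    proof
      fix n
      \<comment> \<open>The normalising \<open>Gamma (\<mu> + p + real n)\<close> of the shifted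
        density equals \<open>Gamma (\<mu> + p)\<close> times a Pochhammer symbol. That symbol is
        the additional numerator parameter which turns Kummer coefficients into Gauss
        coefficients.\<close>
      have "\<mu> + p \<notin> \<int>\<^sub>\<le>\<^sub>0"
        using assms by (auto dest: nonpos_Ints_nonpos)
      then have G: "pochhammer (\<mu> + p) n = Gamma (\<mu> + p + real n) / Gamma (\<mu> + p)"
        by (rule pochhammer_Gamma)
      have P: "x powr (\<mu> + p + real n - 1) = x powr (\<mu> - 1) * x powr p * x ^ n"
        "\<theta>1 powr (\<mu> + p + real n) = \<theta>1 powr \<mu> * \<theta>1 powr p * \<theta>1 ^ n"
        using True \<theta> by (simp_all add: powr_add powr_diff powr_realpow)
      have Q: "(m / (\<mu> * \<kappa> + m)) powr m = \<theta>1 powr m / \<theta>2 powr m"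
        using \<theta> by (simp add: powr_divide flip: ratio)
      have nz: "Gamma (\<mu> + p) > 0" "Gamma \<mu> > 0" "Gamma (\<mu> + p + real n) > 0" "pochhammer \<mu> n > 0"
        using assms by (auto intro!: Gamma_real_pos pochhammer_pos)
      show "B * (pochhammer m n / (pochhammer \<mu> n * fact n) * (z * (x / \<theta>1)) ^ n) =
          A * c n * gamma_density (\<mu> + p + real n) \<theta>1 x"
        using True nz \<theta> unfolding A_def B_def c_def gamma_density_def G P Q
        by (simp add: powr_diff power_mult_distrib power_divide field_simps)
    qed
    finally show ?thesis .
  qed
  have "has_bochner_integral lborel (\<lambda>x. kms_density \<kappa> \<mu> m x * x powr p) (A * gauss_2F1 (\<mu> + p) m \<mu> z)"
  proof (rule has_bochner_integral_nn_integral)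
    \<comment> \<open>Measurability is inherited from the Gamma densities, through the pointwise
      convergent series.\<close>
    show "(\<lambda>x. kms_density \<kappa> \<mu> m x * x powr p) \<in> borel_measurable lborel"
      unfolding sums[THEN sums_unique] by measurable
    have nonneg: "0 \<le> A * c n * gamma_density (\<mu> + p + real n) \<theta>1 x" for n x
      using A c assms by (simp add: gamma_density_nonneg)
    show "AE x in lborel. 0 \<le> kms_density \<kappa> \<mu> m x * x powr p"
      using assms by (simp add: kms_density_nonneg)
    show "0 \<le> A * gauss_2F1 (\<mu> + p) m \<mu> z"
      unfolding gauss using A c summable_c by (intro mult_nonneg_nonneg suminf_nonneg)
    \<comment> \<open>All terms are nonnegative, so sum and integral may be exchanged; each Gamma
      density has mass 1 and only the coefficients remain.\<close>
    have "(\<integral>\<^sup>+x. ennreal (kms_density \<kappa> \<mu> m x * x powr p) \<partial>lborel) =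
        (\<integral>\<^sup>+x. (\<Sum>n. ennreal (A * c n * gamma_density (\<mu> + p + real n) \<theta>1 x)) \<partial>lborel)"
      by (simp only: suminf_ennreal_eq[OF nonneg sums])
    also have "\<dots> = (\<Sum>n. \<integral>\<^sup>+x. ennreal (A * c n * gamma_density (\<mu> + p + real n) \<theta>1 x) \<partial>lborel)"
      by (intro nn_integral_suminf) measurable
    also have "\<dots> = (\<Sum>n. ennreal (A * c n))"
      using A c assms \<theta>
      by (simp add: ennreal_mult' nn_integral_cmult nn_integral_gamma_density gamma_density_nonneg)
    also have "\<dots> = ennreal (A * gauss_2F1 (\<mu> + p) m \<mu> z)"
      unfolding gauss
      by (rule suminf_ennreal_eq[OF mult_nonneg_nonneg[OF A c] sums_mult[OF summable_sums[OF summable_c]]])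
    finally show "(\<integral>\<^sup>+x. ennreal (kms_density \<kappa> \<mu> m x * x powr p) \<partial>lborel) =
        ennreal (A * gauss_2F1 (\<mu> + p) m \<mu> z)" .
  qed
  then show ?thesis
    by (simp add: A_def z_def \<theta>1_def)
qed

text \<open>Transfers integrability and value together from the density side to the probability
  space, so that finiteness of the moments needs no separate argument.\<close>

lemma has_bochner_integral_distributed:
  fixes f g :: "real \<Rightarrow> real"
  assumes "distributed M lborel X (\<lambda>x. ennreal (f x))" "\<And>x. 0 \<le> f x" "g \<in> borel_measurable borel"
    and "has_bochner_integral lborel (\<lambda>x. f x * g x) I"
  shows "has_bochner_integral M (\<lambda>\<omega>. g (X \<omega>)) I"
  using assms distributed_integral[of M lborel X f g] distributed_integrable[of M lborel X f g]
  by (simp add: has_bochner_integral_iff)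

section \<open>The error vector magnitude\<close>

theorem theorem2:
  fixes M :: "'a measure"
    and g\<^sub>d :: "'a \<Rightarrow> real" and g :: "nat \<Rightarrow> 'a \<Rightarrow> real"
    and L :: nat and \<kappa> \<mu> m m\<^sub>I \<sigma> :: real
  assumes "prob_space M"
    and "L \<ge> 1" and "\<sigma>\<^sup>2 > 0" and "m\<^sub>I > 0"
    and "\<kappa> > 0" and "\<mu> > 0" and "m > 0"
    and "prob_space.indep_vars M (\<lambda>_. borel) (\<lambda>l. if l = 0 then g\<^sub>d else g l) {0..L}"
    and "kms_power_rv M g\<^sub>d \<kappa> \<mu> m"
    and "\<And>l. l \<in> {1..L} \<Longrightarrow> nakagami_power_rv M (g l) m\<^sub>I"
    and "\<mu> > 1 / 2"
  shows "EVM M g\<^sub>d g L (\<sigma>\<^sup>2) =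
    tricomi_U (m\<^sub>I * real L) (3 / 2 + m\<^sub>I * real L) (\<sigma>\<^sup>2 * m\<^sub>I)
      * sqrt (\<sigma>\<^sup>2 * \<mu> * (1 + \<kappa>)) * (m / (\<mu> * \<kappa> + m)) powr m * Gamma (\<mu> - 1 / 2)
      * gauss_2F1 (\<mu> - 1 / 2) m \<mu> (\<mu> * \<kappa> / (m + \<mu> * \<kappa>))
    / ((\<sigma>\<^sup>2 * m\<^sub>I) powr (- (m\<^sub>I * real L)) * Gamma \<mu>)"
proof -
  interpret prob_space M by fact
  let ?X = "\<lambda>l. if l = 0 then g\<^sub>d else g l"
  let ?S = "\<lambda>\<omega>. \<Sum>l=1..L. g l \<omega>"
  \<comment> \<open>Index 0 carries the desired signal. Splitting it off exhibits the signal as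
    independent of the sum over the interferers.\<close>
  have insert: "{0..L} = insert 0 {1..L}"
    by auto
  have sum_X: "(\<Sum>l=1..L. ?X l \<omega>) = ?S \<omega>" for \<omega>
    by (intro sum.cong) auto
  have k: "m\<^sub>I * real L > 0"
    using assms by simp
  have "distributed M lborel (\<lambda>\<omega>. \<Sum>l=1..L. ?X l \<omega>)
      (\<lambda>x. ennreal (gamma_density (\<Sum>l=1..L. m\<^sub>I) (1 / m\<^sub>I) x))"
  proof (rule gamma_distributed_sum)
    show "indep_vars (\<lambda>_. borel) ?X {1..L}"
      by (rule indep_vars_subset[OF assms(8)]) auto
  qed (use assms in \<open>auto simp: nakagami_power_rv_def\<close>)
  then have S: "distributed M lborel ?S (\<lambda>x. ennreal (gamma_density (m\<^sub>I * real L) (1 / m\<^sub>I) x))"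
    by (simp add: sum_X mult.commute)
  \<comment> \<open>With scale \<open>1 / m\<^sub>I\<close> and shift
    \<open>\<sigma>\<^sup>2\<close>, the quotient \<open>v / \<theta>\<close> becomes
    \<open>\<sigma>\<^sup>2 * m\<^sub>I\<close>.\<close>
  have sqrt_S: "has_bochner_integral M (\<lambda>\<omega>. sqrt (?S \<omega> + \<sigma>\<^sup>2))
      ((\<sigma>\<^sup>2 * m\<^sub>I) powr (m\<^sub>I * real L) * sqrt (\<sigma>\<^sup>2)
        * tricomi_U (m\<^sub>I * real L) (3 / 2 + m\<^sub>I * real L) (\<sigma>\<^sup>2 * m\<^sub>I))"
    using has_bochner_integral_gamma_density_sqrt[OF k, of "1 / m\<^sub>I" "\<sigma>\<^sup>2"] assms(3,4) k
    by (intro has_bochner_integral_distributed[OF S]) (auto simp: gamma_density_nonneg simp del: real_sqrt_abs)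
  \<comment> \<open>The moment of order \<open>p = - 1 / 2\<close>; its condition
    \<open>\<mu> + p > 0\<close> is exactly \<open>\<mu> > 1 / 2\<close>.\<close>
  have "has_bochner_integral lborel (\<lambda>x. kms_density \<kappa> \<mu> m x * x powr (- 1 / 2))
      ((m / (\<mu> * \<kappa> + m)) powr m * kms_theta1 \<kappa> \<mu> powr (- 1 / 2) * Gamma (\<mu> + (- 1 / 2)) / Gamma \<mu>
      * gauss_2F1 (\<mu> + (- 1 / 2)) m \<mu> (\<mu> * \<kappa> / (m + \<mu> * \<kappa>)))"
    using assms by (intro has_bochner_integral_kms_density_powr) auto
  \<comment> \<open>For negative \<open>x\<close> the two functions need not agree, but the density
    vanishes there.\<close>
  moreover have "kms_density \<kappa> \<mu> m x * x powr (- 1 / 2) = kms_density \<kappa> \<mu> m x * (1 / sqrt x)" for x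
    by (cases "x > 0") (auto simp: powr_minus_divide powr_half_sqrt kms_density_def)
  moreover have "kms_theta1 \<kappa> \<mu> powr (- 1 / 2) = sqrt (\<mu> * (1 + \<kappa>))"
    using assms by (simp add: kms_theta1_def powr_minus_divide powr_half_sqrt real_sqrt_divide)
  moreover have "\<mu> + (- 1 / 2) = \<mu> - 1 / 2"
    by simp
  ultimately have *: "has_bochner_integral lborel (\<lambda>x. kms_density \<kappa> \<mu> m x * (1 / sqrt x))
      ((m / (\<mu> * \<kappa> + m)) powr m * sqrt (\<mu> * (1 + \<kappa>)) * Gamma (\<mu> - 1 / 2) / Gamma \<mu>
      * gauss_2F1 (\<mu> - 1 / 2) m \<mu> (\<mu> * \<kappa> / (m + \<mu> * \<kappa>)))"
    by (simp only:)
  have "distributed M lborel g\<^sub>d (\<lambda>x. ennreal (kms_density \<kappa> \<mu> m x))"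
    using assms(9) by (simp only: kms_power_rv_def)
  then have g\<^sub>d: "has_bochner_integral M (\<lambda>\<omega>. 1 / sqrt (g\<^sub>d \<omega>))
      ((m / (\<mu> * \<kappa> + m)) powr m * sqrt (\<mu> * (1 + \<kappa>)) * Gamma (\<mu> - 1 / 2) / Gamma \<mu>
      * gauss_2F1 (\<mu> - 1 / 2) m \<mu> (\<mu> * \<kappa> / (m + \<mu> * \<kappa>)))"
    by (rule has_bochner_integral_distributed[OF _ kms_density_nonneg[OF assms(5-7)] _ *]) measurable
  have "indep_var borel (?X 0) borel (\<lambda>\<omega>. \<Sum>l=1..L. ?X l \<omega>)"
    using assms(8) unfolding insert by (intro indep_vars_sum) auto
  then have "indep_var borel g\<^sub>d borel ?S"
    by (simp only: sum_X simp_thms if_True)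
  then have "indep_var borel ((\<lambda>x. 1 / sqrt x) \<circ> g\<^sub>d) borel ((\<lambda>s. sqrt (s + \<sigma>\<^sup>2)) \<circ> ?S)"
    by (rule indep_var_compose) auto
  then have "expectation (\<lambda>\<omega>. 1 / sqrt (g\<^sub>d \<omega>) * sqrt (?S \<omega> + \<sigma>\<^sup>2)) =
      expectation (\<lambda>\<omega>. 1 / sqrt (g\<^sub>d \<omega>)) * expectation (\<lambda>\<omega>. sqrt (?S \<omega> + \<sigma>\<^sup>2))"
    unfolding o_def using g\<^sub>d sqrt_S
    by (intro indep_var_lebesgue_integral) (simp_all only: has_bochner_integral_iff)
  \<comment> \<open>\<open>sqrt\<close> is odd on the reals and division by 0 gives 0, so the root
    of a quotient splits at every point, even where \<open>g\<^sub>d\<close> is not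
    positive.\<close>
  moreover have "EVM M g\<^sub>d g L (\<sigma>\<^sup>2) = expectation (\<lambda>\<omega>. 1 / sqrt (g\<^sub>d \<omega>) * sqrt (?S \<omega> + \<sigma>\<^sup>2))"
    by (simp add: EVM_def real_sqrt_divide)
  moreover note has_bochner_integral_integral_eq[OF g\<^sub>d] has_bochner_integral_integral_eq[OF sqrt_S]
  moreover have "sqrt (\<sigma>\<^sup>2 * \<mu> * (1 + \<kappa>)) = sqrt (\<sigma>\<^sup>2) * sqrt (\<mu> * (1 + \<kappa>))"
    by (simp only: mult.assoc flip: real_sqrt_mult)
  moreover have "a / ((\<sigma>\<^sup>2 * m\<^sub>I) powr (- (m\<^sub>I * real L)) * b) = a * (\<sigma>\<^sup>2 * m\<^sub>I) powr (m\<^sub>I * real L) / b" for a b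
    by (simp add: powr_minus_divide)
  ultimately show ?thesis
    by (simp only: times_divide_eq_left times_divide_eq_right mult_ac)
qed

end
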